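(* Assume that $f\in L^2(\Omega)$ and that the coefficient matrix $A$ and the domain $\Omega$ are such that for every $g\in L^2(\Omega)$ the problem $-A:D^2 v=g$ in $\Omega$, $v=0$ on $\partial\Omega$, has a unique solution $v\in V$. Let $\mathcal{J}$ be either of the two functionals $\mathcal{J}_h(\cdot,\cdot;f)$ or $\mathcal{J}_0(\cdot,\cdot;f)$ defined in the context. Then the least-squares problem: find $(u,\boldsymbol\sigma)\in H^1_0(\Omega)\times Q$ such that $$\mathcal{J}(u,\boldsymbol\sigma;f)=\inf_{(v,\boldsymbol\tau)\in H^1_0(\Omega)\times Q}\mathcal{J}(v,\boldsymbol\tau;f)$$ has a unique solution $(u,\boldsymbol\sigma)\in H_0^1(\Omega)\times Q$.
   Context: Setting: $d\in\{2,3\}$, $\Omega\subset\mathbb{R}^d$ is a bounded open polytope, $A=(a_{ij})\in L^\infty(\Omega)^{d\times d}$ (not necessarily differentiable or continuous; it may even be degenerate as long as the stated existence and uniqueness assumption holds). For matrices, $A:B=\sum_{i,j}a_{ij}b_{ij}$; $D^2v$ is the Hessian. $\|\cdot\|_{k,\omega}$ is the $H^k(\omega)$ norm, with $\omega$ omitted when $\omega=\Omega$; $\|\cdot\|_0$ is the $L^2(\Omega)$ norm. Spaces: $V=\{v\in H^1_0(\Omega): A:D^2v\in L^2(\Omega)\}$ and $Q=\{\boldsymbol\tau\in L^2(\Omega)^d: A:\nabla\boldsymbol\tau\in L^2(\Omega)\}$. Convention: $A:\nabla\boldsymbol\tau=\sum_{i,j}a_{ij}\,\partial_j\tau_i$ is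 linear in $\boldsymbol\tau$, coincides with the a.e. pointwise expression when $\boldsymbol\tau\in H^1(\Omega)^d$, and satisfies $A:\nabla(\nabla v)=A:D^2v$ for $v\in H_0^1(\Omega)$ (so for such $v$, $\nabla v\in Q$ if and only if $v\in V$). Mesh: $\mathcal{T}=\{K\}$ is a shape-regular simplicial triangulation of $\Omega$ (not necessarily quasi-uniform), $h_K=\operatorname{diam}K$. Functionals, for $(v,\boldsymbol\tau)\in H^1_0(\Omega)\times Q$: $$\mathcal{J}_h(v,\boldsymbol\tau;f)=\sum_{K\in\mathcal{T}}h_K^2\|f+A:\nabla\boldsymbol\tau\|_{0,K}^2+\|\boldsymbol\tau-\nabla v\|_0^2,\qquad \mathcal{J}_0(v,\boldsymbol\tau;f)=\|f+A:\nabla\boldsymbol\tau\|_0^2+\|\boldsymbol\tau-\nabla v\|_0^2 .$$ *)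

theory Defs
  imports "HOL-Analysis.Analysis"
begin

section \<open>Lebesgue spaces\<close>

text \<open>
  Elements of Lebesgue and Sobolev spaces are represented by functions on the whole of
  \<open>\<real>\<^sup>d\<close>, whose values outside \<open>\<Omega>\<close> are irrelevant; two functions represent the same
  element if they agree almost everywhere on \<open>\<Omega>\<close>.
\<close>

definition ae_eq :: "'a::euclidean_space set \<Rightarrow> ('a \<Rightarrow> 'b) \<Rightarrow> ('a \<Rightarrow> 'b) \<Rightarrow> bool" where
  "ae_eq \<Omega> f g \<longleftrightarrow> (AE x in lebesgue_on \<Omega>. f x = g x)"

definition L2 :: "'a::euclidean_space set \<Rightarrow> ('a \<Rightarrow> 'b::euclidean_space) set" where
  "L2 \<Omega> = {f \<in> borel_measurable (lebesgue_on \<Omega>).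
            integrable (lebesgue_on \<Omega>) (\<lambda>x. (norm (f x))\<^sup>2)}"

definition L2_norm_on :: "'a::euclidean_space set \<Rightarrow> ('a \<Rightarrow> 'b::euclidean_space) \<Rightarrow> real" where
  "L2_norm_on \<omega> f = sqrt (LINT x|lebesgue_on \<omega>. (norm (f x))\<^sup>2)"

definition Linf :: "'a::euclidean_space set \<Rightarrow> ('a \<Rightarrow> 'b::euclidean_space) set" where
  "Linf \<Omega> = {f \<in> borel_measurable (lebesgue_on \<Omega>).
              \<exists>C. AE x in lebesgue_on \<Omega>. norm (f x) \<le> C}"


section \<open>Test functions, weak derivatives and Sobolev spaces\<close>

definition partial_deriv :: "'d::finite \<Rightarrow> (real ^ 'd \<Rightarrow> real) \<Rightarrow> real ^ 'd \<Rightarrow> real" where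
  "partial_deriv j \<phi> x = frechet_derivative \<phi> (at x) (axis j 1)"

fun continuously_differentiable :: "nat \<Rightarrow> (real ^ 'd::finite \<Rightarrow> real) \<Rightarrow> bool" where
  "continuously_differentiable 0 \<phi> \<longleftrightarrow> continuous_on UNIV \<phi>"
| "continuously_differentiable (Suc k) \<phi> \<longleftrightarrow>
     (\<forall>x. \<phi> differentiable (at x)) \<and> (\<forall>j. continuously_differentiable k (partial_deriv j \<phi>))"

definition test_functions :: "(real ^ 'd::finite) set \<Rightarrow> (real ^ 'd \<Rightarrow> real) set" where
  "test_functions \<Omega> = {\<phi>. (\<forall>k. continuously_differentiable k \<phi>) \<and>
     compact (closure {x. \<phi> x \<noteq> 0}) \<and> closure {x. \<phi> x \<noteq> 0} \<subseteq> \<Omega>}"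

definition has_weak_partial ::
  "(real ^ 'd::finite) set \<Rightarrow> 'd \<Rightarrow> (real ^ 'd \<Rightarrow> real) \<Rightarrow> (real ^ 'd \<Rightarrow> real) \<Rightarrow> bool" where
  "has_weak_partial \<Omega> j v g \<longleftrightarrow>
     (\<forall>\<phi>\<in>test_functions \<Omega>.
        (LINT x|lebesgue_on \<Omega>. v x * partial_deriv j \<phi> x) = - (LINT x|lebesgue_on \<Omega>. g x * \<phi> x))"

definition H1 :: "(real ^ 'd::finite) set \<Rightarrow> (real ^ 'd \<Rightarrow> real) set" where
  "H1 \<Omega> = {v \<in> L2 \<Omega>. \<forall>j. \<exists>g\<in>L2 \<Omega>. has_weak_partial \<Omega> j v g}"

text \<open>A representative of the weak partial derivative, meaningful for \<open>v \<in> H1 \<Omega>\<close>.\<close>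

definition weak_partial :: "(real ^ 'd::finite) set \<Rightarrow> 'd \<Rightarrow> (real ^ 'd \<Rightarrow> real) \<Rightarrow> real ^ 'd \<Rightarrow> real" where
  "weak_partial \<Omega> j v = (SOME g. g \<in> L2 \<Omega> \<and> has_weak_partial \<Omega> j v g)"

definition weak_grad :: "(real ^ 'd::finite) set \<Rightarrow> (real ^ 'd \<Rightarrow> real) \<Rightarrow> real ^ 'd \<Rightarrow> real ^ 'd" where
  "weak_grad \<Omega> v x = (\<chi> j. weak_partial \<Omega> j v x)"

definition H1_norm :: "(real ^ 'd::finite) set \<Rightarrow> (real ^ 'd \<Rightarrow> real) \<Rightarrow> real" where
  "H1_norm \<Omega> v = sqrt ((L2_norm_on \<Omega> v)\<^sup>2 + (L2_norm_on \<Omega> (weak_grad \<Omega> v))\<^sup>2)"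

definition H1_0 :: "(real ^ 'd::finite) set \<Rightarrow> (real ^ 'd \<Rightarrow> real) set" where
  "H1_0 \<Omega> = {v \<in> H1 \<Omega>. \<exists>\<phi>. (\<forall>n::nat. \<phi> n \<in> test_functions \<Omega>) \<and>
              (\<lambda>n. H1_norm \<Omega> (\<lambda>x. v x - \<phi> n x)) \<longlonglongrightarrow> 0}"

definition H1_vec :: "(real ^ 'd::finite) set \<Rightarrow> (real ^ 'd \<Rightarrow> real ^ 'd) set" where
  "H1_vec \<Omega> = {\<tau>. \<forall>i. (\<lambda>x. \<tau> x $ i) \<in> H1 \<Omega>}"

text \<open>The Jacobian, with entries \<open>(i, j) \<mapsto> \<partial>\<^sub>j \<tau>\<^sub>i\<close>.\<close>

definition weak_jacobian ::
  "(real ^ 'd::finite) set \<Rightarrow> (real ^ 'd \<Rightarrow> real ^ 'd) \<Rightarrow> real ^ 'd \<Rightarrow> real ^ 'd ^ 'd" where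
  "weak_jacobian \<Omega> \<tau> x = (\<chi> i j. weak_partial \<Omega> j (\<lambda>y. \<tau> y $ i) x)"

definition frobenius :: "real ^ 'd::finite ^ 'd \<Rightarrow> real ^ 'd ^ 'd \<Rightarrow> real" where
  "frobenius M N = (\<Sum>i\<in>UNIV. \<Sum>j\<in>UNIV. M $ i $ j * N $ i $ j)"


section \<open>The operators \<open>\<tau> \<mapsto> A : \<nabla>\<tau>\<close> and \<open>v \<mapsto> A : D\<^sup>2v\<close>\<close>

text \<open>
  For a merely bounded \<open>A\<close> the expressions \<open>A : \<nabla>\<tau>\<close> with \<open>\<tau> \<in> L\<^sup>2(\<Omega>)\<^sup>d\<close> and
  \<open>A : D\<^sup>2v\<close> with \<open>v \<in> H\<^sup>1\<^sub>0(\<Omega>)\<close> are products of a bounded function with a distribution and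
  have no canonical meaning. All that is required of them is stated in the following locale.
  They take values in a vector space \<open>'y\<close> of generalised functions, into which
  \<open>L\<^sup>2(\<Omega>)\<close> is embedded by \<open>emb\<close>, so that ``\<open>A : \<nabla>\<tau> \<in> L\<^sup>2(\<Omega>)\<close>'' is a genuine condition.
\<close>

locale nondivergence_operators =
  fixes \<Omega> :: "(real ^ 'd::finite) set"
    and A :: "real ^ 'd \<Rightarrow> real ^ 'd ^ 'd"
    and emb :: "(real ^ 'd \<Rightarrow> real) \<Rightarrow> 'y::real_vector"
    and A_grad :: "(real ^ 'd \<Rightarrow> real ^ 'd) \<Rightarrow> 'y"
    and A_hess :: "(real ^ 'd \<Rightarrow> real) \<Rightarrow> 'y"
  assumes emb_add: "\<lbrakk>f \<in> L2 \<Omega>; g \<in> L2 \<Omega>\<rbrakk> \<Longrightarrow> emb (\<lambda>x. f x + g x) = emb f + emb g"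
    and emb_scale: "f \<in> L2 \<Omega> \<Longrightarrow> emb (\<lambda>x. c * f x) = c *\<^sub>R emb f"
    and emb_eq_iff: "\<lbrakk>f \<in> L2 \<Omega>; g \<in> L2 \<Omega>\<rbrakk> \<Longrightarrow> emb f = emb g \<longleftrightarrow> ae_eq \<Omega> f g"
    and A_grad_cong: "\<lbrakk>\<tau> \<in> L2 \<Omega>; \<rho> \<in> L2 \<Omega>; ae_eq \<Omega> \<tau> \<rho>\<rbrakk> \<Longrightarrow> A_grad \<tau> = A_grad \<rho>"
    and A_grad_add: "\<lbrakk>\<tau> \<in> L2 \<Omega>; \<rho> \<in> L2 \<Omega>\<rbrakk> \<Longrightarrow> A_grad (\<lambda>x. \<tau> x + \<rho> x) = A_grad \<tau> + A_grad \<rho>"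
    and A_grad_scale: "\<tau> \<in> L2 \<Omega> \<Longrightarrow> A_grad (\<lambda>x. c *\<^sub>R \<tau> x) = c *\<^sub>R A_grad \<tau>"
    and A_grad_H1: "\<tau> \<in> H1_vec \<Omega> \<Longrightarrow>
          A_grad \<tau> = emb (\<lambda>x. frobenius (A x) (weak_jacobian \<Omega> \<tau> x))"
    and A_grad_weak_grad: "v \<in> H1_0 \<Omega> \<Longrightarrow> A_grad (weak_grad \<Omega> v) = A_hess v"

definition V_space ::
  "(real ^ 'd::finite) set \<Rightarrow> ((real ^ 'd \<Rightarrow> real) \<Rightarrow> 'y) \<Rightarrow> ((real ^ 'd \<Rightarrow> real) \<Rightarrow> 'y)
     \<Rightarrow> (real ^ 'd \<Rightarrow> real) set" where
  "V_space \<Omega> emb A_hess = {v \<in> H1_0 \<Omega>. A_hess v \<in> emb ` L2 \<Omega>}"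

definition Q_space ::
  "(real ^ 'd::finite) set \<Rightarrow> ((real ^ 'd \<Rightarrow> real) \<Rightarrow> 'y) \<Rightarrow> ((real ^ 'd \<Rightarrow> real ^ 'd) \<Rightarrow> 'y)
     \<Rightarrow> (real ^ 'd \<Rightarrow> real ^ 'd) set" where
  "Q_space \<Omega> emb A_grad = {\<tau> \<in> L2 \<Omega>. A_grad \<tau> \<in> emb ` L2 \<Omega>}"

text \<open>The function in \<open>L\<^sup>2(\<Omega>)\<close> represented by a generalised function \<open>y \<in> emb ` L2 \<Omega>\<close>.\<close>

definition L2_rep ::
  "(real ^ 'd::finite) set \<Rightarrow> ((real ^ 'd \<Rightarrow> real) \<Rightarrow> 'y) \<Rightarrow> 'y \<Rightarrow> real ^ 'd \<Rightarrow> real" where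
  "L2_rep \<Omega> emb y = (SOME g. g \<in> L2 \<Omega> \<and> emb g = y)"

text \<open>\<open>v = 0\<close> on the boundary is part of membership in \<open>V_space\<close>.\<close>

definition solves_nondivergence ::
  "(real ^ 'd::finite) set \<Rightarrow> ((real ^ 'd \<Rightarrow> real) \<Rightarrow> 'y::real_vector) \<Rightarrow> ((real ^ 'd \<Rightarrow> real) \<Rightarrow> 'y)
     \<Rightarrow> (real ^ 'd \<Rightarrow> real) \<Rightarrow> (real ^ 'd \<Rightarrow> real) \<Rightarrow> bool" where
  "solves_nondivergence \<Omega> emb A_hess g v \<longleftrightarrow> v \<in> V_space \<Omega> emb A_hess \<and> - A_hess v = emb g"

definition well_posed ::
  "(real ^ 'd::finite) set \<Rightarrow> ((real ^ 'd \<Rightarrow> real) \<Rightarrow> 'y::real_vector) \<Rightarrow> ((real ^ 'd \<Rightarrow> real) \<Rightarrow> 'y)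
     \<Rightarrow> bool" where
  "well_posed \<Omega> emb A_hess \<longleftrightarrow>
     (\<forall>g\<in>L2 \<Omega>. \<exists>v. solves_nondivergence \<Omega> emb A_hess g v \<and>
        (\<forall>w. solves_nondivergence \<Omega> emb A_hess g w \<longrightarrow> ae_eq \<Omega> w v))"


section \<open>Domain and mesh\<close>

text \<open>
  The predicate \<^const>\<open>polytope\<close> of the library describes convex polytopes. As usual for
  finite element domains, the domain here is polygonal or polyhedral but need not be convex.
\<close>

definition open_polytope :: "'a::euclidean_space set \<Rightarrow> bool" where
  "open_polytope \<Omega> \<longleftrightarrow> \<Omega> \<noteq> {} \<and>
     (\<exists>\<P>. finite \<P> \<and> (\<forall>P\<in>\<P>. polytope P) \<and> \<Omega> = interior (\<Union>\<P>))"

definition inradius :: "'a::euclidean_space set \<Rightarrow> real" where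
  "inradius K = Sup {r. r \<ge> 0 \<and> (\<exists>x. cball x r \<subseteq> K)}"

text \<open>Shape regularity is a bound \<open>\<kappa>\<close> on the ratio of the diameter to that of the largest inscribed ball.\<close>

definition shape_regular_mesh :: "real \<Rightarrow> 'a::euclidean_space set \<Rightarrow> 'a set set \<Rightarrow> bool" where
  "shape_regular_mesh \<kappa> \<Omega> \<T> \<longleftrightarrow>
     triangulation \<T> \<and> (\<forall>K\<in>\<T>. int DIM('a) simplex K) \<and> \<Union>\<T> = closure \<Omega> \<and>
     (\<forall>K\<in>\<T>. diameter K \<le> \<kappa> * (2 * inradius K))"


section \<open>Least-squares functionals\<close>

definition J_h ::
  "(real ^ 'd::finite) set \<Rightarrow> ((real ^ 'd \<Rightarrow> real) \<Rightarrow> 'y) \<Rightarrow> ((real ^ 'd \<Rightarrow> real ^ 'd) \<Rightarrow> 'y)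
     \<Rightarrow> (real ^ 'd) set set \<Rightarrow> (real ^ 'd \<Rightarrow> real)
     \<Rightarrow> (real ^ 'd \<Rightarrow> real) \<Rightarrow> (real ^ 'd \<Rightarrow> real ^ 'd) \<Rightarrow> real" where
  "J_h \<Omega> emb A_grad \<T> f v \<tau> =
     (\<Sum>K\<in>\<T>. (diameter K)\<^sup>2 * (L2_norm_on K (\<lambda>x. f x + L2_rep \<Omega> emb (A_grad \<tau>) x))\<^sup>2)
     + (L2_norm_on \<Omega> (\<lambda>x. \<tau> x - weak_grad \<Omega> v x))\<^sup>2"

definition J_0 ::
  "(real ^ 'd::finite) set \<Rightarrow> ((real ^ 'd \<Rightarrow> real) \<Rightarrow> 'y) \<Rightarrow> ((real ^ 'd \<Rightarrow> real ^ 'd) \<Rightarrow> 'y)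
     \<Rightarrow> (real ^ 'd \<Rightarrow> real)
     \<Rightarrow> (real ^ 'd \<Rightarrow> real) \<Rightarrow> (real ^ 'd \<Rightarrow> real ^ 'd) \<Rightarrow> real" where
  "J_0 \<Omega> emb A_grad f v \<tau> =
     (L2_norm_on \<Omega> (\<lambda>x. f x + L2_rep \<Omega> emb (A_grad \<tau>) x))\<^sup>2
     + (L2_norm_on \<Omega> (\<lambda>x. \<tau> x - weak_grad \<Omega> v x))\<^sup>2"

definition is_least_squares_solution ::
  "(real ^ 'd::finite) set \<Rightarrow> ((real ^ 'd \<Rightarrow> real) \<Rightarrow> 'y) \<Rightarrow> ((real ^ 'd \<Rightarrow> real ^ 'd) \<Rightarrow> 'y)
     \<Rightarrow> ((real ^ 'd \<Rightarrow> real) \<Rightarrow> (real ^ 'd \<Rightarrow> real ^ 'd) \<Rightarrow> real)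
     \<Rightarrow> (real ^ 'd \<Rightarrow> real) \<Rightarrow> (real ^ 'd \<Rightarrow> real ^ 'd) \<Rightarrow> bool" where
  "is_least_squares_solution \<Omega> emb A_grad J u \<sigma> \<longleftrightarrow>
     u \<in> H1_0 \<Omega> \<and> \<sigma> \<in> Q_space \<Omega> emb A_grad \<and>
     J u \<sigma> = (INF (v, \<tau>) \<in> H1_0 \<Omega> \<times> Q_space \<Omega> emb A_grad. J v \<tau>)"

end

theory Submission
  imports Defs
begin

text \<open>
  If \<open>u \<in> V\<close> solves \<open>- A : D\<^sup>2u = f\<close>, then the nonnegative functional vanishes at \<open>(u, \<nabla>u)\<close>, so its
  infimum is zero. Conversely, at any zero \<open>(v, \<tau>)\<close> of the functional \<open>\<tau> = \<nabla>v\<close> and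
  \<open>A : D\<^sup>2v = A : \<nabla>\<tau> = - f\<close>, so \<open>v = u\<close> by well-posedness and \<open>\<tau> = \<nabla>u\<close>. The mesh-dependent
  weights do not matter because they are positive and the boundary of \<open>\<Omega>\<close> is a null set.
\<close>

section \<open>Closure properties of \<open>L2\<close> and vanishing of the norm\<close>

lemma L2_measurable: "f \<in> L2 \<Omega> \<Longrightarrow> f \<in> borel_measurable (lebesgue_on \<Omega>)"
  by (simp add: L2_def)

lemma L2_scaleR: "f \<in> L2 \<Omega> \<Longrightarrow> (\<lambda>x. c *\<^sub>R f x) \<in> L2 \<Omega>"
  by (auto simp: L2_def power_mult_distrib)

text \<open>The sum is dominated through \<open>(a + b)^2 <= 2 * a^2 + 2 * b^2\<close>, so no
  Cauchy-Schwarz inequality for integrals is involved.\<close>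

lemma L2_add:
  fixes f g :: "'a::euclidean_space \<Rightarrow> 'b::euclidean_space"
  assumes f: "f \<in> L2 \<Omega>" and g: "g \<in> L2 \<Omega>"
  shows "(\<lambda>x. f x + g x) \<in> L2 \<Omega>"
proof -
  have m: "f \<in> borel_measurable (lebesgue_on \<Omega>)" "g \<in> borel_measurable (lebesgue_on \<Omega>)"
    using f g by (auto intro: L2_measurable)
  have bound: "(norm (f x + g x))\<^sup>2 \<le> 2 * (norm (f x))\<^sup>2 + 2 * (norm (g x))\<^sup>2" for x
  proof -
    have "(norm (f x + g x))\<^sup>2 \<le> (norm (f x) + norm (g x))\<^sup>2"
      by (simp add: norm_triangle_ineq power_mono)
    also have "\<dots> \<le> 2 * (norm (f x))\<^sup>2 + 2 * (norm (g x))\<^sup>2"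
      using sum_squares_bound[of "norm (f x)" "norm (g x)"] by (simp add: power2_sum)
    finally show ?thesis .
  qed
  have "integrable (lebesgue_on \<Omega>) (\<lambda>x. 2 * (norm (f x))\<^sup>2 + 2 * (norm (g x))\<^sup>2)"
    using f g by (intro Bochner_Integration.integrable_add integrable_mult_right) (auto simp: L2_def)
  then have "integrable (lebesgue_on \<Omega>) (\<lambda>x. (norm (f x + g x))\<^sup>2)"
    by (rule Bochner_Integration.integrable_bound) (use m bound in auto)
  then show ?thesis
    using m by (auto simp: L2_def)
qed

lemma L2_uminus: "f \<in> L2 \<Omega> \<Longrightarrow> (\<lambda>x. - f x) \<in> L2 \<Omega>"
  using L2_scaleR[of f \<Omega> "-1"] by simp

lemma L2_diff: "f \<in> L2 \<Omega> \<Longrightarrow> g \<in> L2 \<Omega> \<Longrightarrow> (\<lambda>x. f x - g x) \<in> L2 \<Omega>"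
  using L2_add[of f \<Omega> "\<lambda>x. - g x"] L2_uminus[of g] by simp

lemma L2_vec:
  fixes f :: "'a::euclidean_space \<Rightarrow> real ^ 'd::finite"
  assumes "\<And>j. (\<lambda>x. f x $ j) \<in> L2 \<Omega>"
  shows "f \<in> L2 \<Omega>"
proof -
  have "f \<in> borel_measurable (lebesgue_on \<Omega>)"
    using assms
    by (subst borel_measurable_euclidean_space) (auto simp: Basis_vec_def inner_axis L2_measurable)
  moreover have "integrable (lebesgue_on \<Omega>) (\<lambda>x. \<Sum>j\<in>UNIV. (norm (f x $ j))\<^sup>2)"
    using assms by (intro Bochner_Integration.integrable_sum) (auto simp: L2_def)
  moreover have "(norm (f x))\<^sup>2 = (\<Sum>j\<in>UNIV. (norm (f x $ j))\<^sup>2)" for x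
    by (simp add: norm_vec_def L2_set_def sum_nonneg)
  ultimately show ?thesis
    by (simp add: L2_def)
qed

text \<open>Integrability is essential here: the integral of a non-integrable function is 0 by
  convention, so a vanishing \<open>L2_norm_on\<close> alone says nothing about
  \<open>f\<close>.\<close>

lemma L2_norm_on_power2_eq_0_iff:
  assumes "integrable (lebesgue_on \<omega>) (\<lambda>x. (norm (f x))\<^sup>2)"
  shows "(L2_norm_on \<omega> f)\<^sup>2 = 0 \<longleftrightarrow> (AE x in lebesgue_on \<omega>. f x = 0)"
  using integral_nonneg_eq_0_iff_AE[OF assms] by (simp add: L2_norm_on_def)

section \<open>Weak derivatives and chosen representatives\<close>

text \<open>The function enters the definition only through an integral against derivatives of test
  functions, and the integral ignores null sets.\<close>

lemma has_weak_partial_cong: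
  assumes "u \<in> L2 \<Omega>" "v \<in> L2 \<Omega>" "ae_eq \<Omega> u v" "\<Omega> \<in> sets lebesgue"
  shows "has_weak_partial \<Omega> j u g \<longleftrightarrow> has_weak_partial \<Omega> j v g"
proof -
  have "(LINT x|lebesgue_on \<Omega>. u x * partial_deriv j \<phi> x) =
        (LINT x|lebesgue_on \<Omega>. v x * partial_deriv j \<phi> x)" if "\<phi> \<in> test_functions \<Omega>" for \<phi>
  proof -
    \<comment> \<open>One level of smoothness gives continuous partial derivatives, hence the
      measurability that \<open>integral_cong_AE\<close> asks for.\<close>
    have "continuously_differentiable (Suc 0) \<phi>"
      using that unfolding test_functions_def by blast
    then have "continuous_on \<Omega> (partial_deriv j \<phi>)"
      using continuous_on_subset[of UNIV "partial_deriv j \<phi>" \<Omega>] by simp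
    then have [measurable]: "partial_deriv j \<phi> \<in> borel_measurable (lebesgue_on \<Omega>)"
      using assms(4) by (rule continuous_imp_measurable_on_sets_lebesgue)
    have [measurable]: "u \<in> borel_measurable (lebesgue_on \<Omega>)" "v \<in> borel_measurable (lebesgue_on \<Omega>)"
      using assms by (auto intro: L2_measurable)
    show ?thesis
      using assms(3) by (intro integral_cong_AE) (auto simp: ae_eq_def)
  qed
  then show ?thesis
    by (simp add: has_weak_partial_def)
qed

text \<open>
  The representatives chosen by \<^const>\<open>weak_partial\<close> agree everywhere, since they are chosen
  from the same set.
\<close>

lemma weak_grad_cong:
  assumes "u \<in> L2 \<Omega>" "v \<in> L2 \<Omega>" "ae_eq \<Omega> u v" "\<Omega> \<in> sets lebesgue"
  shows "weak_grad \<Omega> u = weak_grad \<Omega> v"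
  unfolding weak_grad_def weak_partial_def has_weak_partial_cong[OF assms] ..

lemma weak_grad_L2:
  assumes "v \<in> H1 \<Omega>"
  shows "weak_grad \<Omega> v \<in> L2 \<Omega>"
proof (rule L2_vec)
  fix j
  have "\<exists>g. g \<in> L2 \<Omega> \<and> has_weak_partial \<Omega> j v g"
    using assms by (auto simp: H1_def)
  from someI_ex[OF this] show "(\<lambda>x. weak_grad \<Omega> v x $ j) \<in> L2 \<Omega>"
    by (simp add: weak_grad_def weak_partial_def)
qed

lemma L2_rep:
  assumes "y \<in> emb ` L2 \<Omega>"
  shows "L2_rep \<Omega> emb y \<in> L2 \<Omega>" and "emb (L2_rep \<Omega> emb y) = y"
proof -
  have "\<exists>g. g \<in> L2 \<Omega> \<and> emb g = y"
    using assms by blast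
  from someI_ex[OF this] show "L2_rep \<Omega> emb y \<in> L2 \<Omega>" "emb (L2_rep \<Omega> emb y) = y"
    by (simp_all add: L2_rep_def)
qed

section \<open>Null boundary of the domain and positive mesh weights\<close>

lemma open_polytope_open: "open_polytope \<Omega> \<Longrightarrow> open \<Omega>"
  by (auto simp: open_polytope_def)

text \<open>The boundary lies in the finitely many frontiers of the convex pieces, and a convex set
  has a null frontier.\<close>

lemma open_polytope_negligible_frontier:
  assumes "open_polytope \<Omega>"
  shows "negligible (closure \<Omega> - \<Omega>)"
proof -
  obtain \<P> where \<P>: "finite \<P>" "\<And>P. P \<in> \<P> \<Longrightarrow> polytope P" "\<Omega> = interior (\<Union>\<P>)"
    using assms by (auto simp: open_polytope_def)
  have "closure \<Omega> - \<Omega> = frontier \<Omega>"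
    using open_polytope_open[OF assms] by (simp add: frontier_def interior_open)
  also have "\<dots> \<subseteq> frontier (\<Union>\<P>)"
    unfolding \<P>(3) by (rule frontier_interior_subset)
  also have "\<dots> \<subseteq> (\<Union>P\<in>\<P>. frontier P)"
    using \<P>(1) by (rule frontier_Union_subset)
  finally have "closure \<Omega> - \<Omega> \<subseteq> (\<Union>P\<in>\<P>. frontier P)" .
  moreover have "negligible (\<Union>P\<in>\<P>. frontier P)"
    using \<P> by (intro negligible_Union)
      (auto intro!: negligible_convex_frontier polytope_imp_convex)
  ultimately show ?thesis
    by (rule negligible_subset[rotated])
qed

text \<open>A simplex of positive dimension has two distinct vertices, whose distance bounds the
  diameter from below.\<close>

lemma simplex_diameter_pos:
  assumes "n simplex K" "n > 0"
  shows "diameter K > 0"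
proof -
  obtain C where C: "finite C" "int (card C) = n + 1" "K = convex hull C"
    using assms(1) by (auto simp: simplex)
  then have "\<not> card C \<le> Suc 0"
    using assms(2) by linarith
  then obtain x y where xy: "x \<in> C" "y \<in> C" "x \<noteq> y"
    using C(1) card_le_Suc0_iff_eq by blast
  have "bounded K"
    using C by (simp add: finite_imp_bounded bounded_convex_hull)
  then have "dist x y \<le> diameter K"
    using xy C(3) by (intro diameter_bounded_bound) (auto intro: hull_inc)
  then show ?thesis
    using xy(3) zero_less_dist_iff[of x y] by linarith
qed

lemma AE_lebesgue_on_iff:
  "S \<in> sets lebesgue \<Longrightarrow> (AE x in lebesgue_on S. P x) \<longleftrightarrow> (AE x in lebesgue. x \<in> S \<longrightarrow> P x)"
  by (simp add: AE_restrict_space_iff)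

lemma mesh_residual_eq_0_iff:
  fixes \<Omega> :: "'a::euclidean_space set" and r :: "'a \<Rightarrow> 'b::euclidean_space"
  assumes \<Omega>: "open_polytope \<Omega>" and mesh: "shape_regular_mesh \<kappa> \<Omega> \<T>" and r: "r \<in> L2 \<Omega>"
  shows "(\<Sum>K\<in>\<T>. (diameter K)\<^sup>2 * (L2_norm_on K r)\<^sup>2) = 0 \<longleftrightarrow> (AE x in lebesgue_on \<Omega>. r x = 0)"
proof -
  have fin: "finite \<T>" and simp: "\<And>K. K \<in> \<T> \<Longrightarrow> int DIM('a) simplex K"
    and un: "\<Union>\<T> = closure \<Omega>"
    using mesh by (auto simp: shape_regular_mesh_def triangulation_def)
  have \<Omega>_meas: "\<Omega> \<in> sets lebesgue"
    using open_polytope_open[OF \<Omega>] by simp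
  have K_meas: "K \<in> sets lebesgue" if "K \<in> \<T>" for K
    using simp[OF that] by (auto simp: simplex finite_imp_compact_convex_hull compact_imp_closed)
  have null: "negligible (closure \<Omega> - \<Omega>)"
    using \<Omega> by (rule open_polytope_negligible_frontier)
  have K_sub: "negligible (K - \<Omega>)" if "K \<in> \<T>" for K
    using null un that by (auto intro: negligible_subset)
  \<comment> \<open>A closed simplex may contain boundary points of \<Omega>, where nothing is known
    about \<open>r\<close>. Integrability is therefore shown on \<open>\<Omega> \<inter> K\<close>
    and carried over to \<open>K\<close>, which differs by a null set.\<close>
  have K_int: "integrable (lebesgue_on K) (\<lambda>x. (norm (r x))\<^sup>2)" if "K \<in> \<T>" for K
  proof -
    have "(\<lambda>x. (norm (r x))\<^sup>2) absolutely_integrable_on \<Omega>"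
      using r \<Omega>_meas by (simp add: L2_def set_integrable_def integrable_restrict_space)
    then have "(\<lambda>x. (norm (r x))\<^sup>2) absolutely_integrable_on (\<Omega> \<inter> K)"
      by (rule set_integrable_subset) (use \<Omega>_meas K_meas[OF that] in auto)
    then have "(\<lambda>x. (norm (r x))\<^sup>2) absolutely_integrable_on K"
      by (rule absolutely_integrable_spike_set)
        (auto intro: negligible_subset[OF K_sub[OF that]])
    then show ?thesis
      using K_meas[OF that] by (simp add: set_integrable_def integrable_restrict_space)
  qed
  have "(\<Sum>K\<in>\<T>. (diameter K)\<^sup>2 * (L2_norm_on K r)\<^sup>2) = 0
      \<longleftrightarrow> (\<forall>K\<in>\<T>. (diameter K)\<^sup>2 * (L2_norm_on K r)\<^sup>2 = 0)"
    using fin by (intro sum_nonneg_eq_0_iff) auto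
  \<comment> \<open>Passing from the measures on the single simplices to one common measure lets the
    quantifier over the finite mesh move inside \<open>AE\<close>.\<close>
  also have "\<dots> \<longleftrightarrow> (\<forall>K\<in>\<T>. AE x in lebesgue. x \<in> K \<longrightarrow> r x = 0)"
  proof (rule ball_cong[OF refl])
    fix K assume K: "K \<in> \<T>"
    have "diameter K > 0"
      using simp[OF K] by (rule simplex_diameter_pos) simp
    then have "(diameter K)\<^sup>2 * (L2_norm_on K r)\<^sup>2 = 0 \<longleftrightarrow> (L2_norm_on K r)\<^sup>2 = 0"
      by simp
    also have "\<dots> \<longleftrightarrow> (AE x in lebesgue. x \<in> K \<longrightarrow> r x = 0)"
      by (simp only: L2_norm_on_power2_eq_0_iff[OF K_int[OF K]] AE_lebesgue_on_iff[OF K_meas[OF K]])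
    finally show "(diameter K)\<^sup>2 * (L2_norm_on K r)\<^sup>2 = 0 \<longleftrightarrow>
      (AE x in lebesgue. x \<in> K \<longrightarrow> r x = 0)" .
  qed
  also have "\<dots> \<longleftrightarrow> (AE x in lebesgue. \<forall>K\<in>\<T>. x \<in> K \<longrightarrow> r x = 0)"
    using fin by (intro AE_finite_all[symmetric])
  also have "\<dots> \<longleftrightarrow> (AE x in lebesgue. x \<in> closure \<Omega> \<longrightarrow> r x = 0)"
    unfolding un[symmetric] by (intro arg_cong[where f = "\<lambda>P. AE x in lebesgue. P x"]) auto
  \<comment> \<open>Off the null set \<open>closure \<Omega> - \<Omega>\<close> both predicates
    agree.\<close>
  also have "\<dots> \<longleftrightarrow> (AE x in lebesgue. x \<in> \<Omega> \<longrightarrow> r x = 0)"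
  proof -
    have "AE x in lebesgue. x \<notin> closure \<Omega> - \<Omega>"
      using null by (intro AE_not_in) (simp add: negligible_iff_null_sets)
    then show ?thesis
      by (intro eventually_subst, eventually_elim) (use closure_subset[of \<Omega>] in auto)
  qed
  finally show ?thesis
    by (simp add: AE_lebesgue_on_iff[OF \<Omega>_meas])
qed

section \<open>Zeros of the functionals and the abstract minimisation argument\<close>

context nondivergence_operators
begin

lemma emb_uminus: "f \<in> L2 \<Omega> \<Longrightarrow> emb (\<lambda>x. - f x) = - emb f"
  using emb_scale[of f "-1"] by simp

lemma residual_L2:
  assumes "f \<in> L2 \<Omega>" "\<tau> \<in> Q_space \<Omega> emb A_grad"
  shows "(\<lambda>x. f x + L2_rep \<Omega> emb (A_grad \<tau>) x) \<in> L2 \<Omega>"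
  using assms by (intro L2_add L2_rep) (auto simp: Q_space_def)

text \<open>Since \<open>emb\<close> is injective up to null sets, a pointwise statement about the
  chosen representative becomes an identity in \<open>'y\<close>, free of that choice.\<close>

lemma residual_eq_0_iff:
  assumes f: "f \<in> L2 \<Omega>" and \<tau>: "\<tau> \<in> Q_space \<Omega> emb A_grad"
  shows "(AE x in lebesgue_on \<Omega>. f x + L2_rep \<Omega> emb (A_grad \<tau>) x = 0) \<longleftrightarrow> A_grad \<tau> = - emb f"
proof -
  let ?g = "L2_rep \<Omega> emb (A_grad \<tau>)"
  have "A_grad \<tau> \<in> emb ` L2 \<Omega>"
    using \<tau> by (simp add: Q_space_def)
  note g = L2_rep[OF this]
  have "(AE x in lebesgue_on \<Omega>. f x + ?g x = 0) \<longleftrightarrow> ae_eq \<Omega> ?g (\<lambda>x. - f x)"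
    unfolding ae_eq_def by (simp add: add.commute eq_neg_iff_add_eq_0)
  also have "\<dots> \<longleftrightarrow> emb ?g = emb (\<lambda>x. - f x)"
    using emb_eq_iff[OF g(1) L2_uminus[OF f]] by simp
  finally show ?thesis
    using g(2) emb_uminus[OF f] by simp
qed

lemma flux_residual_eq_0_iff:
  assumes "v \<in> H1_0 \<Omega>" "\<tau> \<in> Q_space \<Omega> emb A_grad"
  shows "(L2_norm_on \<Omega> (\<lambda>x. \<tau> x - weak_grad \<Omega> v x))\<^sup>2 = 0 \<longleftrightarrow> ae_eq \<Omega> \<tau> (weak_grad \<Omega> v)"
proof -
  have "(\<lambda>x. \<tau> x - weak_grad \<Omega> v x) \<in> L2 \<Omega>"
    using assms by (intro L2_diff weak_grad_L2) (auto simp: Q_space_def H1_0_def)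
  then show ?thesis
    by (subst L2_norm_on_power2_eq_0_iff) (auto simp: L2_def ae_eq_def)
qed

lemma J_0_eq_0_iff:
  assumes "f \<in> L2 \<Omega>" "v \<in> H1_0 \<Omega>" "\<tau> \<in> Q_space \<Omega> emb A_grad"
  shows "J_0 \<Omega> emb A_grad f v \<tau> = 0 \<longleftrightarrow> A_grad \<tau> = - emb f \<and> ae_eq \<Omega> \<tau> (weak_grad \<Omega> v)"
proof -
  have "(L2_norm_on \<Omega> (\<lambda>x. f x + L2_rep \<Omega> emb (A_grad \<tau>) x))\<^sup>2 = 0 \<longleftrightarrow> A_grad \<tau> = - emb f"
    using residual_L2[OF assms(1,3)] residual_eq_0_iff[OF assms(1,3)]
    by (subst L2_norm_on_power2_eq_0_iff) (auto simp: L2_def)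
  then show ?thesis
    unfolding J_0_def flux_residual_eq_0_iff[OF assms(2,3), symmetric]
    by (simp add: add_nonneg_eq_0_iff)
qed

text \<open>The weighted sum over the mesh vanishes exactly when the residual vanishes on \<Omega>,
  so the zeros are those of \<open>J_0\<close>.\<close>

lemma J_h_eq_0_iff:
  assumes "open_polytope \<Omega>" "shape_regular_mesh \<kappa> \<Omega> \<T>"
    and "f \<in> L2 \<Omega>" "v \<in> H1_0 \<Omega>" "\<tau> \<in> Q_space \<Omega> emb A_grad"
  shows "J_h \<Omega> emb A_grad \<T> f v \<tau> = 0 \<longleftrightarrow> A_grad \<tau> = - emb f \<and> ae_eq \<Omega> \<tau> (weak_grad \<Omega> v)"
  unfolding J_h_def flux_residual_eq_0_iff[OF assms(4,5), symmetric]
    residual_eq_0_iff[OF assms(3,5), symmetric]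
    mesh_residual_eq_0_iff[OF assms(1,2) residual_L2[OF assms(3,5)], symmetric]
  by (intro add_nonneg_eq_0_iff sum_nonneg) auto

text \<open>\<open>J\<close> is kept abstract: only its nonnegativity and its zeros enter, which
  settles both functionals with one argument.\<close>

lemma least_squares_unique_solution:
  assumes \<Omega>: "\<Omega> \<in> sets lebesgue" and f: "f \<in> L2 \<Omega>" and wp: "well_posed \<Omega> emb A_hess"
    and J_nonneg: "\<And>v \<tau>. J v \<tau> \<ge> 0"
    and J_eq_0_iff: "\<And>v \<tau>. \<lbrakk>v \<in> H1_0 \<Omega>; \<tau> \<in> Q_space \<Omega> emb A_grad\<rbrakk> \<Longrightarrow>
      J v \<tau> = 0 \<longleftrightarrow> A_grad \<tau> = - emb f \<and> ae_eq \<Omega> \<tau> (weak_grad \<Omega> v)"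
  shows "\<exists>u \<sigma>. is_least_squares_solution \<Omega> emb A_grad J u \<sigma> \<and>
           (\<forall>u' \<sigma>'. is_least_squares_solution \<Omega> emb A_grad J u' \<sigma>' \<longrightarrow>
              ae_eq \<Omega> u' u \<and> ae_eq \<Omega> \<sigma>' \<sigma>)"
proof -
  obtain u where u: "solves_nondivergence \<Omega> emb A_hess f u"
    and u_unique: "\<And>w. solves_nondivergence \<Omega> emb A_hess f w \<Longrightarrow> ae_eq \<Omega> w u"
    using wp f unfolding well_posed_def by blast
  let ?\<sigma> = "weak_grad \<Omega> u"
  have L2: "v \<in> L2 \<Omega>" "weak_grad \<Omega> v \<in> L2 \<Omega>" if "v \<in> H1_0 \<Omega>" for v
    using that weak_grad_L2 by (auto simp: H1_0_def H1_def)
  have uH: "u \<in> H1_0 \<Omega>" and uV: "A_hess u \<in> emb ` L2 \<Omega>" and u_eq: "- A_hess u = emb f"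
    using u by (auto simp: solves_nondivergence_def V_space_def)
  have \<sigma>Q: "?\<sigma> \<in> Q_space \<Omega> emb A_grad"
    using uV L2[OF uH] by (simp add: Q_space_def A_grad_weak_grad[OF uH])
  have "A_grad ?\<sigma> = - emb f"
    using u_eq by (metis A_grad_weak_grad[OF uH] minus_minus)
  then have zero: "J u ?\<sigma> = 0"
    using J_eq_0_iff[OF uH \<sigma>Q] by (simp add: ae_eq_def)
  \<comment> \<open>The lower bound 0 is attained at \<open>(u, ?\<sigma>)\<close>, so minimisers
    are exactly the admissible zeros of \<open>J\<close>.\<close>
  have Inf: "(INF (v, \<tau>) \<in> H1_0 \<Omega> \<times> Q_space \<Omega> emb A_grad. J v \<tau>) = 0"
  proof (rule cInf_eq_minimum)
    show "0 \<in> (\<lambda>(v, \<tau>). J v \<tau>) ` (H1_0 \<Omega> \<times> Q_space \<Omega> emb A_grad)"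
      using zero uH \<sigma>Q by (auto intro!: image_eqI[where x = "(u, ?\<sigma>)"])
  qed (use J_nonneg in auto)
  show ?thesis
  proof (intro exI conjI allI impI)
    show "is_least_squares_solution \<Omega> emb A_grad J u ?\<sigma>"
      using zero uH \<sigma>Q Inf by (simp add: is_least_squares_solution_def)
  next
    fix u' \<sigma>'
    assume "is_least_squares_solution \<Omega> emb A_grad J u' \<sigma>'"
    then have H: "u' \<in> H1_0 \<Omega>" and Q: "\<sigma>' \<in> Q_space \<Omega> emb A_grad" and "J u' \<sigma>' = 0"
      using Inf by (auto simp: is_least_squares_solution_def)
    then have eq: "A_grad \<sigma>' = - emb f" and ae: "ae_eq \<Omega> \<sigma>' (weak_grad \<Omega> u')"
      using J_eq_0_iff by auto
    \<comment> \<open>\<open>A_grad\<close> depends only on the class up to null sets, so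
      \<open>\<sigma>'\<close> may be replaced by the weak gradient of \<open>u'\<close>.\<close>
    have A_hess_u': "A_hess u' = A_grad \<sigma>'"
      using A_grad_cong[OF _ L2(2)[OF H] ae] Q A_grad_weak_grad[OF H] by (simp add: Q_space_def)
    then have "solves_nondivergence \<Omega> emb A_hess f u'"
      using H Q by (simp add: solves_nondivergence_def V_space_def Q_space_def A_hess_u' eq)
    then show u': "ae_eq \<Omega> u' u"
      by (rule u_unique)
    \<comment> \<open>As \<open>u'\<close> and \<open>u\<close> agree almost everywhere, their
      chosen gradients are the same function.\<close>
    show "ae_eq \<Omega> \<sigma>' ?\<sigma>"
      using ae weak_grad_cong[OF L2(1)[OF H] L2(1)[OF uH] u' \<Omega>] by simp
  qed
qed

end

theorem theorem2p10:
  fixes \<Omega> :: "(real ^ 'd::finite) set"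
    and A :: "real ^ 'd \<Rightarrow> real ^ 'd ^ 'd"
    and emb :: "(real ^ 'd \<Rightarrow> real) \<Rightarrow> 'y::real_vector"
    and A_grad :: "(real ^ 'd \<Rightarrow> real ^ 'd) \<Rightarrow> 'y"
    and A_hess :: "(real ^ 'd \<Rightarrow> real) \<Rightarrow> 'y"
    and \<T> :: "(real ^ 'd) set set"
    and \<kappa> :: real
    and f :: "real ^ 'd \<Rightarrow> real"
    and J :: "(real ^ 'd \<Rightarrow> real) \<Rightarrow> (real ^ 'd \<Rightarrow> real ^ 'd) \<Rightarrow> real"
  assumes "CARD('d) \<in> {2, 3}"
    and "open_polytope \<Omega>"
    and "A \<in> Linf \<Omega>"
    and "nondivergence_operators \<Omega> A emb A_grad A_hess"
    and "shape_regular_mesh \<kappa> \<Omega> \<T>"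
    and "f \<in> L2 \<Omega>"
    and "well_posed \<Omega> emb A_hess"
    and "J = J_h \<Omega> emb A_grad \<T> f \<or> J = J_0 \<Omega> emb A_grad f"
  shows "\<exists>u \<sigma>. is_least_squares_solution \<Omega> emb A_grad J u \<sigma> \<and>
           (\<forall>u' \<sigma>'. is_least_squares_solution \<Omega> emb A_grad J u' \<sigma>' \<longrightarrow>
              ae_eq \<Omega> u' u \<and> ae_eq \<Omega> \<sigma>' \<sigma>)"
proof -
  interpret nondivergence_operators \<Omega> A emb A_grad A_hess
    by fact
  have \<Omega>: "\<Omega> \<in> sets lebesgue"
    using open_polytope_open[OF assms(2)] by simp
  have "J v \<tau> \<ge> 0" for v \<tau>
    using assms(8) by (auto simp: J_h_def J_0_def intro!: add_nonneg_nonneg sum_nonneg)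
  moreover have "J v \<tau> = 0 \<longleftrightarrow> A_grad \<tau> = - emb f \<and> ae_eq \<Omega> \<tau> (weak_grad \<Omega> v)"
    if "v \<in> H1_0 \<Omega>" "\<tau> \<in> Q_space \<Omega> emb A_grad" for v \<tau>
    using assms(8) J_0_eq_0_iff[OF assms(6) that] J_h_eq_0_iff[OF assms(2,5,6) that] by auto
  ultimately show ?thesis
    by (rule least_squares_unique_solution[OF \<Omega> assms(6,7)])
qed

end
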